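(* Let $X_1,\dots,X_n$ be i.i.d. $\mathbf X$-valued random variables with common density $s_\star\in L^2(\mu)$. Let $\delta\in(0,1)$, $\epsilon\in(0,1/4)$ and $\alpha>0$. Let $(\psi_\lambda)_{\lambda\in\Lambda}$ be an orthonormal system in $L^2(\mu)$, $\Lambda_M\subset\Lambda$ a finite subset, $(\Lambda_m)_{m\in\mathcal M}$ a collection of subsets of $\Lambda_M$, and, for $m\in\mathcal M$, let $S_m$ be the linear span of $(\psi_\lambda)_{\lambda\in\Lambda_m}$. Let $(\hat s_\theta)_{\theta\in\Theta}$ be a collection of estimators of $s_\star$; for each $\theta\in\Theta$ let $\mathcal M_\theta$ be a (possibly random) nonempty subset of $\mathcal M$ and, for $m\in\mathcal M_\theta$, let $\breve s_{\theta,m}$ be an estimator with values in $S_m$. Let $\pi$ be a probability measure on $\Lambda_M$ and, for all $\lambda\in\Lambda_M$, let $\mathcal B_\lambda$ be a regular partition of $\{1,\dots,n\}$ with $V_\lambda$ blocks, where $\ln\left(2(\pi(\lambda)\delta)^{-1}\right)\le V_\lambda\le n/2$. Let $\mathrm{pen}:\mathcal M\to\mathbb R^+$ satisfy, for all $m\in\mathcal M$, $$\mathrm{pen}(m)\ge\frac{L_4}{\epsilon n}\sum_{\lambda\in\Lambda_m}\mathrm{var}_P(\psi_\lambda)V_\lambda,\qquad L_4=\frac{9L_1^2}4 .$$ Let $$\mathrm{crit}_\alpha(\theta)=\min_{m\in\mathcal M_\theta}\Big\{\|\breve s_{\theta,m}\|^2-2\sum_{\lambda\in\Lambda_m}\langle\breve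 s_{\theta,m},\psi_\lambda\rangle\,\overline P_{\mathcal B_\lambda}\psi_\lambda+\alpha\|\breve s_{\theta,m}-\hat s_\theta\|^2+\mathrm{pen}(m)\Big\}$$ and $\hat\theta\in\arg\min_{\theta\in\Theta}\mathrm{crit}_\alpha(\theta)$. Then, with probability larger than $1-\delta/2$, for all $\theta\in\Theta$, $$\frac{(1-4\epsilon)\wedge\alpha}{2(8+\alpha)}\|\hat s_{\hat\theta}-s_\star\|^2\le\|\hat s_\theta-s_\star\|^2+\min_{m\in\mathcal M_\theta}\left\{\|\hat s_\theta-\breve s_{\theta,m}\|^2+\mathrm{pen}(m)\right\}.$$
   Context: $(\mathbf X,\mathcal X,\mu)$ is a measured space; $\langle\cdot,\cdot\rangle,\|\cdot\|$ are the inner product and norm of $L^2(\mu)$; $P$ is the distribution with density $s_\star$; $Pt=\mathbb E[t(X_1)]$; $\mathrm{var}_P(f)$ is the variance of $f(X_1)$. A partition $\mathcal B=(B_1,\dots,B_V)$ of $\{1,\dots,n\}$ is regular if $|\mathrm{Card}(B_K)-n/V|\le 1$ for all $K$; $P_{B_K}t=\frac1{\mathrm{Card}(B_K)}\sum_{i\in B_K}t(X_i)$ and $\overline P_{\mathcal B}t=\mathrm{Med}\{P_{B_K}t,\ K\le V\}$, where $\mathrm{Med}(a_1,\dots,a_N)$ is any real $b$ with $\mathrm{Card}\{i: a_i\le b\}\ge N/2$ and $\mathrm{Card}\{i:a_i\ge b\}\ge N/2$. $L_1=\sqrt{2/r}$ with $r=(1-\sqrt{1-e^{-2}})/2$ (so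 $L_1\le2\sqrt{6e}$). *)

theory Defs
  imports "HOL-Probability.Probability"
begin

text \<open>
  \<open>L\<^sup>2(\<mu>)\<close> is represented by functions rather than by classes of almost everywhere equal functions:
  its elements are evaluated at the observations. Notions that must not depend on the
  representative (such as membership in a linear span) are stated almost everywhere.
\<close>

definition L2 :: "'a measure \<Rightarrow> ('a \<Rightarrow> real) set" where
  "L2 \<mu> = {f. f \<in> borel_measurable \<mu> \<and> integrable \<mu> (\<lambda>x. (f x)\<^sup>2)}"

definition L2_inner :: "'a measure \<Rightarrow> ('a \<Rightarrow> real) \<Rightarrow> ('a \<Rightarrow> real) \<Rightarrow> real" where
  "L2_inner \<mu> f g = (\<integral>x. f x * g x \<partial>\<mu>)"

definition L2_norm :: "'a measure \<Rightarrow> ('a \<Rightarrow> real) \<Rightarrow> real" where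
  "L2_norm \<mu> f = sqrt (L2_inner \<mu> f f)"

definition orthonormal_system :: "'a measure \<Rightarrow> 'l set \<Rightarrow> ('l \<Rightarrow> 'a \<Rightarrow> real) \<Rightarrow> bool" where
  "orthonormal_system \<mu> \<Lambda> \<psi> \<longleftrightarrow>
     (\<forall>l\<in>\<Lambda>. \<psi> l \<in> L2 \<mu>) \<and>
     (\<forall>l\<in>\<Lambda>. \<forall>l'\<in>\<Lambda>. L2_inner \<mu> (\<psi> l) (\<psi> l') = (if l = l' then 1 else 0))"

text \<open>Only meant for finite index sets \<open>A\<close>.\<close>

definition L2_span :: "'a measure \<Rightarrow> ('l \<Rightarrow> 'a \<Rightarrow> real) \<Rightarrow> 'l set \<Rightarrow> ('a \<Rightarrow> real) set" where
  "L2_span \<mu> \<psi> A = {f \<in> L2 \<mu>. \<exists>c. AE x in \<mu>. f x = (\<Sum>l\<in>A. c l * \<psi> l x)}"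

text \<open>
  A random element of \<open>L\<^sup>2(\<mu>)\<close> that is only required to be defined on the event \<open>D\<close>.
  Measurability is understood in the weak sense; this is implied by measurability for the
  norm Borel sets of \<open>L\<^sup>2(\<mu>)\<close> and by joint measurability of \<open>(\<omega>, x) \<mapsto> T \<omega> x\<close>.
\<close>

definition L2_random_element ::
    "'w measure \<Rightarrow> 'w set \<Rightarrow> 'a measure \<Rightarrow> ('w \<Rightarrow> 'a \<Rightarrow> real) \<Rightarrow> bool" where
  "L2_random_element \<Omega> D \<mu> T \<longleftrightarrow>
     (\<forall>\<omega>\<in>D. T \<omega> \<in> L2 \<mu>) \<and>
     (\<forall>f\<in>L2 \<mu>. (\<lambda>\<omega>. L2_inner \<mu> (T \<omega>) f) \<in> borel_measurable (restrict_space \<Omega> D))"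

text \<open>
  The variance takes values in \<open>[0, \<infinity>]\<close>, because \<open>f \<in> L\<^sup>2(\<mu>)\<close> need not be square integrable
  for the law \<open>P\<close>; the real-valued \<open>variance\<close> would silently be \<open>0\<close> in that case.
\<close>

definition evar :: "'a measure \<Rightarrow> ('a \<Rightarrow> real) \<Rightarrow> ennreal" where
  "evar P f = (\<integral>\<^sup>+x. ennreal ((f x - (\<integral>y. f y \<partial>P))\<^sup>2) \<partial>P)"

lemma (in prob_space) evar_eq_variance:
  assumes "f \<in> borel_measurable M" "integrable M (\<lambda>x. (f x)\<^sup>2)"
  shows "evar M f = ennreal (variance f)"
proof -
  have "integrable M f"
    using assms by (rule square_integrable_imp_integrable)
  then have "integrable M (\<lambda>x. (f x - expectation f)\<^sup>2)"
    using assms by (simp add: power2_diff)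
  then show ?thesis
    unfolding evar_def by (intro nn_integral_eq_integral) auto
qed

definition regular_partition :: "nat \<Rightarrow> nat \<Rightarrow> (nat \<Rightarrow> nat set) \<Rightarrow> bool" where
  "regular_partition n V B \<longleftrightarrow>
     partition_on {1..n} (B ` {1..V}) \<and> inj_on B {1..V} \<and>
     (\<forall>K\<in>{1..V}. \<bar>real (card (B K)) - real n / real V\<bar> \<le> 1)"

definition block_mean :: "(nat \<Rightarrow> 'a) \<Rightarrow> nat set \<Rightarrow> ('a \<Rightarrow> real) \<Rightarrow> real" where
  "block_mean x B t = (\<Sum>i\<in>B. t (x i)) / real (card B)"

text \<open>Medians are not unique, hence a predicate.\<close>

definition is_median :: "nat \<Rightarrow> (nat \<Rightarrow> real) \<Rightarrow> real \<Rightarrow> bool" where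
  "is_median N a b \<longleftrightarrow>
     real (card {i\<in>{1..N}. a i \<le> b}) \<ge> real N / 2 \<and>
     real (card {i\<in>{1..N}. a i \<ge> b}) \<ge> real N / 2"

definition r_const :: real where
  "r_const = (1 - sqrt (1 - exp (-2))) / 2"

definition L1_const :: real where
  "L1_const = sqrt (2 / r_const)"

definition L4_const :: real where
  "L4_const = 9 * L1_const\<^sup>2 / 4"

text \<open>
  The value of the criterion at one parameter and one outcome: \<open>shat\<close> is the estimator,
  \<open>Ms\<close> its set of models, \<open>sb m\<close> its approximation in model \<open>m\<close>, and \<open>Pb l\<close> stands for the
  median of block means of \<open>\<psi> l\<close>. The minimum is written as an infimum, as \<open>Ms\<close> may be infinite.
\<close>

definition crit ::
    "'a measure \<Rightarrow> ('l \<Rightarrow> 'a \<Rightarrow> real) \<Rightarrow> ('m \<Rightarrow> 'l set) \<Rightarrow> ('m \<Rightarrow> real) \<Rightarrow> real \<Rightarrow>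
     ('l \<Rightarrow> real) \<Rightarrow> 'm set \<Rightarrow> ('m \<Rightarrow> 'a \<Rightarrow> real) \<Rightarrow> ('a \<Rightarrow> real) \<Rightarrow> real" where
  "crit \<mu> \<psi> \<Lambda>m pen \<alpha> Pb Ms sb shat =
     (INF m\<in>Ms. (L2_norm \<mu> (sb m))\<^sup>2
        - 2 * (\<Sum>l\<in>\<Lambda>m m. L2_inner \<mu> (sb m) (\<psi> l) * Pb l)
        + \<alpha> * (L2_norm \<mu> (\<lambda>x. sb m x - shat x))\<^sup>2
        + pen m)"

end

theory Submission
  imports Defs
begin

text \<open>
  If the median of the block means of \<open>\<psi>\<^sub>\<lambda>\<close> deviates, so do half of the independent block means, each
  with probability at most \<open>r\<close> by Chebyshev's inequality; the constant \<open>r\<close> is such that Chernoff's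
  method then gives \<open>exp (- V\<^sub>\<lambda>)\<close>. On the resulting event the squared errors of the medians sum over
  \<open>\<Lambda>\<^sub>m\<close> to at most \<open>4 \<epsilon> pen(m) / 9\<close>. Up to the constant \<open>\<parallel>s\<parallel>\<^sup>2\<close> the criterion is the penalised risk
  plus a noise term that is linear in the coefficients. In the comparison of candidates \<open>f\<close> and \<open>g\<close>
  from two models only the difference of their noise terms matters; it is at most
  \<open>4 \<epsilon> (\<parallel>f - s\<parallel>\<^sup>2 + \<parallel>g - s\<parallel>\<^sup>2)\<close> plus a fraction of the two penalties.
\<close>

subsection \<open>Deviations of medians of block means\<close>

text \<open>Expanding the square leaves a double sum whose off-diagonal terms vanish: for
  independent centred variables the expectation of a product is the product of zero means.\<close>

lemma (in prob_space)
  fixes Z :: "'i \<Rightarrow> 'a \<Rightarrow> real"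
  assumes I: "finite I" and ind: "indep_vars (\<lambda>_. borel) Z I"
    and sq: "\<And>i. i \<in> I \<Longrightarrow> integrable M (\<lambda>\<omega>. (Z i \<omega>)\<^sup>2)"
    and centred: "\<And>i. i \<in> I \<Longrightarrow> expectation (Z i) = 0"
  shows integrable_indep_sum_square: "integrable M (\<lambda>\<omega>. (\<Sum>i\<in>I. Z i \<omega>)\<^sup>2)"
    and expectation_indep_sum_square:
      "expectation (\<lambda>\<omega>. (\<Sum>i\<in>I. Z i \<omega>)\<^sup>2) = (\<Sum>i\<in>I. expectation (\<lambda>\<omega>. (Z i \<omega>)\<^sup>2))"
proof -
  have rv: "random_variable borel (Z i)" if "i \<in> I" for i
    using ind that by (auto simp: indep_vars_def)
  have int: "integrable M (Z i)" if "i \<in> I" for i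
    using square_integrable_imp_integrable[OF rv sq] that by auto
  have prod: "integrable M (\<lambda>\<omega>. Z i \<omega> * Z j \<omega>) \<and>
      expectation (\<lambda>\<omega>. Z i \<omega> * Z j \<omega>) = (if i = j then expectation (\<lambda>\<omega>. (Z i \<omega>)\<^sup>2) else 0)"
    if "i \<in> I" "j \<in> I" for i j
  proof (cases "i = j")
    case True
    then show ?thesis using sq[of j] that by (simp add: power2_eq_square)
  next
    case False
    have "indep_vars (\<lambda>_. borel) Z {i, j}"
      using ind that by (rule_tac indep_vars_subset) auto
    moreover have "integrable M (Z k)" if "k \<in> {i, j}" for k
      using int that \<open>i \<in> I\<close> \<open>j \<in> I\<close> by auto
    ultimately show ?thesis
      using indep_vars_integrable[of "{i, j}" Z] indep_vars_lebesgue_integral[of "{i, j}" Z] that False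
      by (simp add: centred)
  qed
  have expand: "(\<Sum>i\<in>I. Z i \<omega>)\<^sup>2 = (\<Sum>i\<in>I. \<Sum>j\<in>I. Z i \<omega> * Z j \<omega>)" for \<omega>
    by (simp add: power2_eq_square sum_product)
  show "integrable M (\<lambda>\<omega>. (\<Sum>i\<in>I. Z i \<omega>)\<^sup>2)"
    unfolding expand using prod by (intro Bochner_Integration.integrable_sum) auto
  have "expectation (\<lambda>\<omega>. (\<Sum>i\<in>I. Z i \<omega>)\<^sup>2) =
      (\<Sum>i\<in>I. \<Sum>j\<in>I. expectation (\<lambda>\<omega>. Z i \<omega> * Z j \<omega>))"
    unfolding expand using prod
    by (subst Bochner_Integration.integral_sum; (intro Bochner_Integration.integrable_sum)?)
       (auto intro!: sum.cong Bochner_Integration.integral_sum)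
  also have "\<dots> = (\<Sum>i\<in>I. \<Sum>j\<in>I. if i = j then expectation (\<lambda>\<omega>. (Z i \<omega>)\<^sup>2) else 0)"
    using prod by (intro sum.cong refl) auto
  also have "\<dots> = (\<Sum>i\<in>I. expectation (\<lambda>\<omega>. (Z i \<omega>)\<^sup>2))"
    using I by simp
  finally show "expectation (\<lambda>\<omega>. (\<Sum>i\<in>I. Z i \<omega>)\<^sup>2) = (\<Sum>i\<in>I. expectation (\<lambda>\<omega>. (Z i \<omega>)\<^sup>2))" .
qed

text \<open>With a strict inequality, Chebyshev's inequality also covers the degenerate case \<open>t = 0\<close>.\<close>

lemma (in prob_space) prob_abs_gt_le:
  fixes Y :: "'a \<Rightarrow> real"
  assumes [measurable]: "random_variable borel Y" and int: "integrable M (\<lambda>\<omega>. (Y \<omega>)\<^sup>2)"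
    and t: "0 \<le> t" and r: "0 \<le> r" and le: "expectation (\<lambda>\<omega>. (Y \<omega>)\<^sup>2) \<le> r * t\<^sup>2"
  shows "prob {\<omega>\<in>space M. t < \<bar>Y \<omega>\<bar>} \<le> r"
proof (cases "t = 0")
  case True
  then have "expectation (\<lambda>\<omega>. (Y \<omega>)\<^sup>2) = 0"
    using le by (intro antisym) auto
  then have "AE \<omega> in M. (Y \<omega>)\<^sup>2 = 0"
    using integral_nonneg_eq_0_iff_AE[OF int] by simp
  then have "prob {\<omega>\<in>space M. t < \<bar>Y \<omega>\<bar>} = 0"
    using True by (intro prob_eq_0_AE) (auto elim!: eventually_mono)
  then show ?thesis using r by simp
next
  case False
  have "prob {\<omega>\<in>space M. t < \<bar>Y \<omega>\<bar>} \<le> prob {\<omega>\<in>space M. t\<^sup>2 \<le> (Y \<omega>)\<^sup>2}"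
    using t by (intro finite_measure_mono) (auto simp flip: abs_le_square_iff)
  also have "\<dots> \<le> expectation (\<lambda>\<omega>. (Y \<omega>)\<^sup>2) / t\<^sup>2"
    using False t by (intro integral_Markov_inequality_measure[where A = "space M", OF int]) auto
  also have "\<dots> \<le> r"
    using le False by (simp add: divide_le_eq)
  finally show ?thesis .
qed

text \<open>
  Chernoff's method: with \<open>w\<close> the square root of the odds \<open>(1 - r) / r\<close>, the product of factors \<open>w\<close>
  (deviating variable) and \<open>1 / w\<close> (other variable) is at least \<open>1\<close> when half of the variables deviate.
\<close>

lemma (in prob_space) prob_half_deviate_le:
  fixes Y :: "'i \<Rightarrow> 'a \<Rightarrow> real"
  assumes I: "finite I" and ind: "indep_vars (\<lambda>_. borel) Y I"
    and r: "0 < r" "r \<le> 1 / 2"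
    and dev: "\<And>i. i \<in> I \<Longrightarrow> prob {\<omega>\<in>space M. t < \<bar>Y i \<omega>\<bar>} \<le> r"
  shows "prob {\<omega>\<in>space M. real (card I) / 2 \<le> real (card {i\<in>I. t < \<bar>Y i \<omega>\<bar>})}
    \<le> (2 * sqrt (r * (1 - r))) ^ card I"
proof -
  define w where "w = sqrt ((1 - r) / r)"
  have w: "1 \<le> w" using r unfolding w_def by (simp add: field_simps)
  define W where "W x = (if t < \<bar>x\<bar> then w else 1 / w)" for x
  have [measurable]: "W \<in> borel_measurable borel" unfolding W_def by measurable
  have rv[measurable]: "random_variable borel (Y i)" if "i \<in> I" for i
    using ind that by (auto simp: indep_vars_def)
  have indW: "indep_vars (\<lambda>_. borel) (\<lambda>i \<omega>. W (Y i \<omega>)) I"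
    using ind by (rule indep_vars_compose2) measurable
  have intW: "integrable M (\<lambda>\<omega>. W (Y i \<omega>))" if "i \<in> I" for i
    using that w by (intro integrable_const_bound[where B = w])
      (auto simp: W_def field_simps intro!: order_trans[OF _ mult_mono[of 1 w 1 w]])
  have EW: "expectation (\<lambda>\<omega>. W (Y i \<omega>)) \<le> 2 * sqrt (r * (1 - r))" if i: "i \<in> I" for i
  proof -
    note [measurable] = rv[OF i]
    let ?A = "{\<omega>\<in>space M. t < \<bar>Y i \<omega>\<bar>}"
    have A: "?A \<in> events" by measurable
    \<comment> \<open>As \<open>W\<close> takes only the values \<open>w\<close> and
      \<open>1 / w\<close>, it is an affine function of the indicator of a deviation, and its mean
      is affine in the deviation probability.\<close>
    have "expectation (\<lambda>\<omega>. W (Y i \<omega>)) =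
        expectation (\<lambda>\<omega>. 1 / w + (w - 1 / w) * indicator ?A \<omega>)"
      by (intro Bochner_Integration.integral_cong) (auto simp: W_def)
    also have "\<dots> = 1 / w + (w - 1 / w) * prob ?A"
    proof -
      have "integrable M (indicator ?A :: _ \<Rightarrow> real)" "expectation (indicator ?A) = prob ?A"
        using A by (auto simp: emeasure_eq_measure)
      then show ?thesis by (simp add: prob_space)
    qed
    \<comment> \<open>The slope \<open>w - 1 / w\<close> is nonnegative because r is at most 1/2, so
      the probability may be replaced by its upper bound.\<close>
    also have "\<dots> \<le> 1 / w + (w - 1 / w) * r"
    proof -
      have "1 / w \<le> w" using w by (simp add: divide_le_eq order_trans[OF _ mult_mono[of 1 w 1 w]])
      then show ?thesis using dev[OF i] by (simp add: mult_left_mono)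
    qed
    also have "\<dots> = (1 - r) / w + w * r"
      by (simp add: algebra_simps diff_divide_distrib)
    \<comment> \<open>The choice of \<open>w\<close> balances the two summands: each equals sqrt (r
      (1 - r)).\<close>
    also have "\<dots> = 2 * sqrt (r * (1 - r))"
    proof -
      obtain a b where ab: "a = sqrt r" "b = sqrt (1 - r)" by simp
      then have "r = a * a" "1 - r = b * b" "0 < a" "0 < b" using r by auto
      moreover have "w = b / a" "sqrt (r * (1 - r)) = a * b"
        by (simp_all add: w_def ab real_sqrt_divide real_sqrt_mult)
      ultimately show ?thesis by simp
    qed
    finally show ?thesis .
  qed
  have prod1: "1 \<le> (\<Prod>i\<in>I. W (Y i \<omega>))"
    if "real (card I) / 2 \<le> real (card {i\<in>I. t < \<bar>Y i \<omega>\<bar>})" for \<omega>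
  proof -
    let ?D = "{i\<in>I. t < \<bar>Y i \<omega>\<bar>}" and ?E = "{i\<in>I. \<not> t < \<bar>Y i \<omega>\<bar>}"
    have split: "card I = card ?D + card ?E"
      using I by (subst card_Un_disjoint[symmetric]) (auto intro!: arg_cong[where f = card])
    then have le: "card ?E \<le> card ?D" using that by linarith
    have "(\<Prod>i\<in>I. W (Y i \<omega>)) = w ^ card ?D * (1 / w) ^ card ?E"
      unfolding W_def using I by (simp add: prod.If_cases Int_def Collect_neg_eq[symmetric])
    also have "\<dots> = w ^ (card ?D - card ?E)"
      using w le by (simp add: power_diff power_one_over)
    finally show ?thesis using w by simp
  qed
  have "prob {\<omega>\<in>space M. real (card I) / 2 \<le> real (card {i\<in>I. t < \<bar>Y i \<omega>\<bar>})}
      \<le> prob {\<omega>\<in>space M. 1 \<le> (\<Prod>i\<in>I. W (Y i \<omega>))}"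
    using prod1 by (intro finite_measure_mono) auto
  \<comment> \<open>Markov's inequality at level 1; independence then factorises the
    expectation.\<close>
  also have "\<dots> \<le> expectation (\<lambda>\<omega>. \<Prod>i\<in>I. W (Y i \<omega>)) / 1"
    using w indep_vars_integrable[OF I indW intW]
    by (intro integral_Markov_inequality_measure[where A = "space M"])
       (auto simp: W_def intro!: prod_nonneg)
  also have "\<dots> = (\<Prod>i\<in>I. expectation (\<lambda>\<omega>. W (Y i \<omega>)))"
    using indep_vars_lebesgue_integral[OF I indW intW] by simp
  also have "\<dots> \<le> (\<Prod>i\<in>I. 2 * sqrt (r * (1 - r)))"
    using w EW by (intro prod_mono conjI integral_nonneg) (auto simp: W_def)
  also have "\<dots> = (2 * sqrt (r * (1 - r))) ^ card I" by simp
  finally show ?thesis .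
qed

section \<open>The constant r and the block means of a regular partition\<close>

lemma r_const_bounds: "0 < r_const" "r_const \<le> 1 / 2"
  unfolding r_const_def by (auto simp: real_sqrt_lt_1_iff)

text \<open>By its definition r is the smaller root of 4 r (1 - r) = exp (-2). Each block thus
  contributes a factor exp (-1) to the Chernoff bound.\<close>

lemma r_const_odds: "2 * sqrt (r_const * (1 - r_const)) = exp (-1)"
proof -
  have "4 * (r_const * (1 - r_const)) = 1 - (sqrt (1 - exp (-2)))\<^sup>2"
    unfolding r_const_def by (simp add: field_simps power2_eq_square)
  also have "\<dots> = (exp (-1))\<^sup>2"
    by (simp flip: exp_double)
  finally have "sqrt (4 * (r_const * (1 - r_const))) = exp (-1)"
    by (simp only: real_sqrt_abs) simp
  then show ?thesis by (simp add: real_sqrt_mult)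
qed

text \<open>Every block has at least n / (2 V) points, so a block mean has variance at most 2 V / n
  times that of \<open>f\<close>. The threshold \<open>t\<close> is tuned so that this bound is r
  times its square, and Chebyshev's inequality gives each block a deviation probability of at most
  r.\<close>

lemma (in prob_space) prob_half_blocks_deviate_le:
  assumes ind: "indep_vars (\<lambda>_. N) X {1..n}"
    and law: "\<And>i. i \<in> {1..n} \<Longrightarrow> distr M N (X i) = P"
    and f: "f \<in> borel_measurable N" and sq: "integrable P (\<lambda>x. (f x)\<^sup>2)"
    and B: "regular_partition n V B" and V: "0 < V" "real V \<le> real n / 2"
  defines "p \<equiv> (\<integral>x. f x \<partial>P)"
  defines "t \<equiv> L1_const * sqrt ((\<integral>x. (f x - p)\<^sup>2 \<partial>P) * real V / real n)"
  shows "{\<omega>\<in>space M. real V / 2 \<le>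
      real (card {K\<in>{1..V}. t < \<bar>block_mean (\<lambda>i. X i \<omega>) (B K) f - p\<bar>})} \<in> events" (is "?meas")
    and "prob {\<omega>\<in>space M. real V / 2 \<le>
      real (card {K\<in>{1..V}. t < \<bar>block_mean (\<lambda>i. X i \<omega>) (B K) f - p\<bar>})} \<le> exp (- real V)" (is ?le)
proof -
  define Y where "Y K \<omega> = block_mean (\<lambda>i. X i \<omega>) (B K) f - p" for K \<omega>
  define \<sigma>2 where "\<sigma>2 = (\<integral>x. (f x - p)\<^sup>2 \<partial>P)"
  have n: "0 < n" using V by simp
  have X[measurable]: "X i \<in> measurable M N" if "i \<in> {1..n}" for i
    using ind that by (auto simp: indep_vars_def)
  note [measurable] = f
  have P: "prob_space P" and setsP[measurable_cong]: "sets P = sets N"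
    using law[of 1] n prob_space_distr[OF X[of 1]] by auto
  interpret P: prob_space P by fact
  have fP: "f \<in> borel_measurable P" by measurable
  have intf: "integrable P f"
    using fP sq by (rule P.square_integrable_imp_integrable)
  have intc: "integrable P (\<lambda>x. (f x - p)\<^sup>2)"
    using sq intf by (simp add: power2_diff)
  have sub: "B K \<subseteq> {1..n}" if "K \<in> {1..V}" for K
    using B that unfolding regular_partition_def partition_on_def by auto
  have disj: "disjoint_family_on B {1..V}"
    using B unfolding regular_partition_def partition_on_def disjoint_def disjoint_family_on_def inj_on_def
    by (metis imageI)
  \<comment> \<open>Regularity loses at most 1 from n / V. As V is at most n / 2, this loss is at
    most half of n / V.\<close>
  have card: "real n / (2 * real V) \<le> real (card (B K))" if "K \<in> {1..V}" for K
  proof -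
    have "1 \<le> real n / (2 * real V)" using V by (simp add: field_simps)
    moreover have "\<bar>real (card (B K)) - real n / real V\<bar> \<le> 1"
      using B that by (auto simp: regular_partition_def)
    moreover have "real n / real V = real n / (2 * real V) + real n / (2 * real V)" by simp
    ultimately show ?thesis by linarith
  qed
  have cardpos: "0 < real (card (B K))" if "K \<in> {1..V}" for K
    using card[OF that] n V by (rule_tac less_le_trans[of _ "real n / (2 * real V)"]) auto
  \<comment> \<open>Disjoint blocks of independent observations are independent as vectors, and each
    block mean is a measurable function of its own vector.\<close>
  have indY: "indep_vars (\<lambda>_. borel) Y {1..V}"
  proof -
    have "indep_vars (\<lambda>K. PiM (B K) (\<lambda>_. N)) (\<lambda>K \<omega>. restrict (\<lambda>i. X i \<omega>) (B K)) {1..V}"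
      using ind sub disj by (rule indep_vars_restrict)
    then have "indep_vars (\<lambda>_. borel)
        (\<lambda>K \<omega>. (\<lambda>x. (\<Sum>i\<in>B K. f (x i)) / real (card (B K)) - p) (restrict (\<lambda>i. X i \<omega>) (B K))) {1..V}"
      by (rule indep_vars_compose2) measurable
    moreover have "(\<Sum>i\<in>B K. f (restrict (\<lambda>i. X i \<omega>) (B K) i)) / real (card (B K)) - p = Y K \<omega>" for K \<omega>
      unfolding Y_def block_mean_def by simp
    ultimately show ?thesis by simp
  qed
  have rvY[measurable]: "random_variable borel (Y K)" if "K \<in> {1..V}" for K
    using indY that by (auto simp: indep_vars_def)
  have "L1_const\<^sup>2 = 2 / r_const" using r_const_bounds by (simp add: L1_const_def)
  moreover have \<sigma>2: "0 \<le> \<sigma>2" unfolding \<sigma>2_def by simp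
  ultimately have t2: "r_const * t\<^sup>2 = 2 * \<sigma>2 * real V / real n"
    using r_const_bounds by (simp add: t_def \<sigma>2_def[symmetric] power_mult_distrib)
  have t0: "0 \<le> t" unfolding t_def L1_const_def using r_const_bounds by simp
  have second_moment: "integrable M (\<lambda>\<omega>. (Y K \<omega>)\<^sup>2) \<and> expectation (\<lambda>\<omega>. (Y K \<omega>)\<^sup>2) \<le> r_const * t\<^sup>2"
    if K: "K \<in> {1..V}" for K
  proof -
    define Z where "Z i \<omega> = f (X i \<omega>) - p" for i \<omega>
    have fin: "finite (B K)" using sub[OF K] finite_subset by auto
    have Yeq: "Y K \<omega> = (\<Sum>i\<in>B K. Z i \<omega>) / real (card (B K))" for \<omega>
      using cardpos[OF K] by (simp add: Y_def block_mean_def Z_def sum_subtractf diff_divide_distrib)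
    have indZ: "indep_vars (\<lambda>_. borel) Z (B K)"
      unfolding Z_def
      by (rule indep_vars_compose2[OF indep_vars_subset[OF ind sub[OF K]]]) measurable
    have transfer: "expectation (\<lambda>\<omega>. h (X i \<omega>)) = (\<integral>x. h x \<partial>P)"
      "integrable P h \<Longrightarrow> integrable M (\<lambda>\<omega>. h (X i \<omega>))"
      if "i \<in> B K" "h \<in> borel_measurable N" for i and h :: "_ \<Rightarrow> real"
      using that sub[OF K] law[of i] X[of i] integral_distr[of "X i" M N h] integrable_distr[of "X i" M N h]
      by auto
    have "integrable M (\<lambda>\<omega>. (Z i \<omega>)\<^sup>2)" "expectation (Z i) = 0"
        "expectation (\<lambda>\<omega>. (Z i \<omega>)\<^sup>2) = \<sigma>2" if "i \<in> B K" for i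
      using transfer[OF that, of "\<lambda>x. (f x - p)\<^sup>2"] transfer[OF that, of "\<lambda>x. f x - p"] intc intf
      unfolding Z_def by (simp_all add: \<sigma>2_def p_def P.prob_space)
    with integrable_indep_sum_square[OF fin indZ] expectation_indep_sum_square[OF fin indZ]
    have sum: "integrable M (\<lambda>\<omega>. (\<Sum>i\<in>B K. Z i \<omega>)\<^sup>2)"
      "expectation (\<lambda>\<omega>. (\<Sum>i\<in>B K. Z i \<omega>)\<^sup>2) = real (card (B K)) * \<sigma>2" by auto
    have "expectation (\<lambda>\<omega>. (Y K \<omega>)\<^sup>2) = \<sigma>2 / real (card (B K))"
      using sum(2) cardpos[OF K] by (simp add: Yeq power_divide power2_eq_square)
    also have "\<dots> \<le> \<sigma>2 / (real n / (2 * real V))"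
      using card[OF K] cardpos[OF K] \<sigma>2 n V by (intro divide_left_mono mult_pos_pos) auto
    also have "\<dots> = r_const * t\<^sup>2" by (simp add: t2)
    finally show ?thesis using sum(1) by (simp add: Yeq power_divide)
  qed
  have "prob {\<omega>\<in>space M. t < \<bar>Y K \<omega>\<bar>} \<le> r_const" if "K \<in> {1..V}" for K
    using second_moment[OF that] rvY[OF that] t0 r_const_bounds by (intro prob_abs_gt_le) auto
  then have "prob {\<omega>\<in>space M. real (card {1..V}) / 2 \<le> real (card {K\<in>{1..V}. t < \<bar>Y K \<omega>\<bar>})}
      \<le> exp (-1) ^ card {1..V}"
    unfolding r_const_odds[symmetric] using r_const_bounds by (intro prob_half_deviate_le indY) auto
  then show ?le
    by (simp add: Y_def exp_of_nat_mult[symmetric])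
  have "{\<omega>\<in>space M. real V / 2 \<le> real (card {K\<in>{1..V}. t < \<bar>Y K \<omega>\<bar>})} \<in> events"
  proof -
    \<comment> \<open>Writing the count as a sum of indicators makes its measurability in the
      outcome evident.\<close>
    have "real (card {K\<in>{1..V}. t < \<bar>Y K \<omega>\<bar>}) = (\<Sum>K\<in>{1..V}. if t < \<bar>Y K \<omega>\<bar> then 1 else 0)" for \<omega>
      by (simp add: sum.If_cases Int_def)
    then show ?thesis by simp
  qed
  then show ?meas unfolding Y_def .
qed

text \<open>If the median lies above \<open>p + t\<close>, so do all values at or above the median,
  and these are at least half; the other side is symmetric.\<close>

lemma median_deviation_imp_half_deviate:
  assumes "is_median N a b" "t < \<bar>b - p\<bar>"
  shows "real N / 2 \<le> real (card {i\<in>{1..N}. t < \<bar>a i - p\<bar>})"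
proof -
  have "\<exists>A. A \<subseteq> {i\<in>{1..N}. t < \<bar>a i - p\<bar>} \<and> real N / 2 \<le> real (card A)"
  proof (cases "p \<le> b")
    case True
    then show ?thesis using assms
      by (intro exI[of _ "{i\<in>{1..N}. a i \<ge> b}"]) (auto simp: is_median_def)
  next
    case False
    then show ?thesis using assms
      by (intro exI[of _ "{i\<in>{1..N}. a i \<le> b}"]) (auto simp: is_median_def)
  qed
  then obtain A where "A \<subseteq> {i\<in>{1..N}. t < \<bar>a i - p\<bar>}" "real N / 2 \<le> real (card A)"
    by blast
  moreover from this have "card A \<le> card {i\<in>{1..N}. t < \<bar>a i - p\<bar>}"
    by (intro card_mono) auto
  ultimately show ?thesis by linarith
qed

text \<open>The expectation inside \<open>evar\<close> is a Bochner integral, with default value 0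
  when \<open>f\<close> is not integrable. This does no harm: on a probability space, square
  integrability of \<open>f\<close> minus any constant gives that of \<open>f\<close>, so the
  centring turns out to be the true mean.\<close>

lemma (in prob_space)
  assumes f[measurable]: "f \<in> borel_measurable M" and fin: "evar M f < \<infinity>"
  shows evar_finite_imp_square_integrable: "integrable M (\<lambda>x. (f x)\<^sup>2)"
    and evar_finite_eq_variance: "evar M f = ennreal (variance f)"
proof -
  let ?g = "\<lambda>x. f x - expectation f"
  have g: "integrable M (\<lambda>x. (?g x)\<^sup>2)"
    using fin by (intro integrableI_nonneg) (auto simp: evar_def)
  have "integrable M ?g"
    using _ g by (rule square_integrable_imp_integrable) simp
  with g have "integrable M (\<lambda>x. (?g x)\<^sup>2 + 2 * expectation f * ?g x + (expectation f)\<^sup>2)"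
    by (intro Bochner_Integration.integrable_add integrable_mult_right) auto
  moreover have "(a - c)\<^sup>2 + 2 * c * (a - c) + c\<^sup>2 = a\<^sup>2" for a c :: real
    by (simp add: power2_eq_square algebra_simps)
  ultimately show sq: "integrable M (\<lambda>x. (f x)\<^sup>2)"
    by (simp only:)
  show "evar M f = ennreal (variance f)"
    using f sq by (rule evar_eq_variance)
qed

subsection \<open>Geometry of the criterion\<close>

lemma L2_D:
  assumes "f \<in> L2 M"
  shows "f \<in> borel_measurable M" "integrable M (\<lambda>x. (f x)\<^sup>2)"
  using assms by (auto simp: L2_def)

lemma L2_mult_integrable:
  assumes "f \<in> L2 M" "g \<in> L2 M"
  shows "integrable M (\<lambda>x. f x * g x)"
proof (rule Bochner_Integration.integrable_bound[of _ "\<lambda>x. (f x)\<^sup>2 + (g x)\<^sup>2"])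
  have "\<bar>a * b\<bar> \<le> a\<^sup>2 + b\<^sup>2" for a b :: real
  proof -
    have "2 * (\<bar>a\<bar> * \<bar>b\<bar>) \<le> a\<^sup>2 + b\<^sup>2"
      using sum_squares_bound[of "\<bar>a\<bar>" "\<bar>b\<bar>"] by simp
    moreover have "0 \<le> \<bar>a\<bar> * \<bar>b\<bar>" by simp
    ultimately show ?thesis unfolding abs_mult by linarith
  qed
  then show "AE x in M. norm (f x * g x) \<le> norm ((f x)\<^sup>2 + (g x)\<^sup>2)" by simp
qed (use assms in \<open>auto simp: L2_def\<close>)

lemma L2_diff: "f \<in> L2 M \<Longrightarrow> g \<in> L2 M \<Longrightarrow> (\<lambda>x. f x - g x) \<in> L2 M"
  using L2_mult_integrable[of f M g] by (auto simp: L2_def power2_diff mult.assoc)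

lemma L2_add: "f \<in> L2 M \<Longrightarrow> g \<in> L2 M \<Longrightarrow> (\<lambda>x. f x + g x) \<in> L2 M"
  using L2_mult_integrable[of f M g] by (auto simp: L2_def power2_sum mult.assoc)

lemma L2_scale: "f \<in> L2 M \<Longrightarrow> (\<lambda>x. c * f x) \<in> L2 M"
  by (auto simp: L2_def power_mult_distrib)

lemma L2_sum: "(\<And>i. i \<in> I \<Longrightarrow> f i \<in> L2 M) \<Longrightarrow> (\<lambda>x. \<Sum>i\<in>I. c i * f i x) \<in> L2 M"
proof (induction I rule: infinite_finite_induct)
  case (insert i I)
  then show ?case using L2_add[OF L2_scale[of "f i" M "c i"]] by auto
qed (auto simp: L2_def)

lemma L2_inner_commute: "L2_inner M f g = L2_inner M g f"
  by (simp add: L2_inner_def mult.commute)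

lemma L2_inner_diff_left:
  "f \<in> L2 M \<Longrightarrow> g \<in> L2 M \<Longrightarrow> h \<in> L2 M \<Longrightarrow>
    L2_inner M (\<lambda>x. f x - g x) h = L2_inner M f h - L2_inner M g h"
  by (simp add: L2_inner_def left_diff_distrib L2_mult_integrable)

lemma L2_inner_sum_left:
  assumes "\<And>i. i \<in> I \<Longrightarrow> f i \<in> L2 M" "h \<in> L2 M"
  shows "L2_inner M (\<lambda>x. \<Sum>i\<in>I. c i * f i x) h = (\<Sum>i\<in>I. c i * L2_inner M (f i) h)"
  unfolding L2_inner_def sum_distrib_right mult.assoc
  using assms by (subst Bochner_Integration.integral_sum) (auto intro: L2_mult_integrable)

lemma L2_inner_cong_AE:
  assumes "f \<in> L2 M" "g \<in> L2 M" "h \<in> L2 M" "AE x in M. f x = g x"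
  shows "L2_inner M f h = L2_inner M g h"
  unfolding L2_inner_def using assms by (intro integral_cong_AE) (auto simp: L2_def)

lemma L2_norm_square: "(L2_norm M f)\<^sup>2 = L2_inner M f f"
  by (simp add: L2_norm_def L2_inner_def)

lemma L2_norm_square_diff:
  assumes "f \<in> L2 M" "g \<in> L2 M"
  shows "(L2_norm M (\<lambda>x. f x - g x))\<^sup>2 = (L2_norm M f)\<^sup>2 - 2 * L2_inner M f g + (L2_norm M g)\<^sup>2"
proof -
  have "L2_inner M h (\<lambda>x. f x - g x) = L2_inner M h f - L2_inner M h g" if "h \<in> L2 M" for h
    unfolding L2_inner_commute[of M h] using assms that by (rule L2_inner_diff_left)
  then show ?thesis
    using assms by (simp add: L2_norm_square L2_inner_diff_left L2_diff L2_inner_commute[of M g f])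
qed

lemma L2_norm_diff_commute: "L2_norm M (\<lambda>x. f x - g x) = L2_norm M (\<lambda>x. g x - f x)"
  unfolding L2_norm_def L2_inner_def by (simp add: algebra_simps)

lemma L2_norm_square_diff_le:
  assumes "f \<in> L2 M" "g \<in> L2 M" "h \<in> L2 M"
  shows "(L2_norm M (\<lambda>x. f x - h x))\<^sup>2
    \<le> 2 * (L2_norm M (\<lambda>x. f x - g x))\<^sup>2 + 2 * (L2_norm M (\<lambda>x. g x - h x))\<^sup>2"
proof -
  have int: "integrable M (\<lambda>x. (f x - g x)\<^sup>2)" "integrable M (\<lambda>x. (g x - h x)\<^sup>2)"
      "integrable M (\<lambda>x. (f x - h x)\<^sup>2)"
    using assms by (auto intro!: L2_D(2) L2_diff)
  have "(a - c)\<^sup>2 \<le> 2 * (a - b)\<^sup>2 + 2 * (b - c)\<^sup>2" for a b c :: real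
    using zero_le_power2[of "(a - b) - (b - c)"] by (simp add: power2_eq_square algebra_simps)
  then have "(\<integral>x. (f x - h x)\<^sup>2 \<partial>M) \<le> (\<integral>x. 2 * (f x - g x)\<^sup>2 + 2 * (g x - h x)\<^sup>2 \<partial>M)"
    using int by (intro integral_mono Bochner_Integration.integrable_add integrable_mult_right) auto
  also have "\<dots> = 2 * (\<integral>x. (f x - g x)\<^sup>2 \<partial>M) + 2 * (\<integral>x. (g x - h x)\<^sup>2 \<partial>M)"
    using int by simp
  finally show ?thesis
    unfolding L2_norm_square L2_inner_def by (simp add: power2_eq_square)
qed

section \<open>Orthonormal systems: Bessel's inequality and expansion in a span\<close>

lemma Bessel_inequality:
  assumes on: "orthonormal_system M \<Lambda> \<psi>" and A: "finite A" "A \<subseteq> \<Lambda>" and f: "f \<in> L2 M"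
  shows "(\<Sum>l\<in>A. (L2_inner M f (\<psi> l))\<^sup>2) \<le> (L2_norm M f)\<^sup>2"
proof -
  define c where "c l = L2_inner M f (\<psi> l)" for l
  define g where "g x = (\<Sum>l\<in>A. c l * \<psi> l x)" for x
  have \<psi>: "\<psi> l \<in> L2 M" if "l \<in> A" for l
    using on A that by (auto simp: orthonormal_system_def)
  have g: "g \<in> L2 M" unfolding g_def[abs_def] using \<psi> by (rule L2_sum)
  have inner: "L2_inner M (\<psi> l) (\<psi> l') = (if l = l' then 1 else 0)" if "l \<in> A" "l' \<in> A" for l l'
    using on A that unfolding orthonormal_system_def by (metis subsetD)
  have inner_g: "L2_inner M g h = (\<Sum>l\<in>A. c l * L2_inner M (\<psi> l) h)" if "h \<in> L2 M" for h
    unfolding g_def[abs_def] using \<psi> that by (rule L2_inner_sum_left)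
  have "L2_inner M f g = (\<Sum>l\<in>A. (c l)\<^sup>2)"
    unfolding L2_inner_commute[of M f g] inner_g[OF f]
    by (simp add: c_def L2_inner_commute[of M "\<psi> _" f] power2_eq_square)
  moreover have "L2_inner M g g = (\<Sum>l\<in>A. (c l)\<^sup>2)"
  proof -
    have "L2_inner M (\<psi> l) g = c l" if l: "l \<in> A" for l
    proof -
      have "L2_inner M (\<psi> l) g = (\<Sum>l'\<in>A. c l' * L2_inner M (\<psi> l') (\<psi> l))"
        unfolding L2_inner_commute[of M "\<psi> l" g] using \<psi>[OF l] by (rule inner_g)
      also have "\<dots> = (\<Sum>l'\<in>A. if l' = l then c l' else 0)"
        using l by (intro sum.cong) (auto simp: inner)
      finally show ?thesis using A l by simp
    qed
    then show ?thesis by (simp add: inner_g[OF g] power2_eq_square)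
  qed
  \<comment> \<open>The squared distance from \<open>f\<close> to its projection \<open>g\<close>
    equals the squared norm of \<open>f\<close> minus the sum of squared coefficients.\<close>
  moreover have "0 \<le> (L2_norm M (\<lambda>x. f x - g x))\<^sup>2" by simp
  ultimately show ?thesis
    using L2_norm_square_diff[OF f g] by (simp add: L2_norm_square[of M g] c_def)
qed

text \<open>Orthonormality forces the coefficients of an almost everywhere expansion to be inner
  products with the system. The second claim allows elements of different models to be compared over
  a common index set.\<close>

lemma L2_inner_span:
  assumes on: "orthonormal_system M \<Lambda> \<psi>" and A: "finite A" "A \<subseteq> \<Lambda>" and f: "f \<in> L2_span M \<psi> A"
  shows "g \<in> L2 M \<Longrightarrow> L2_inner M f g = (\<Sum>l\<in>A. L2_inner M f (\<psi> l) * L2_inner M (\<psi> l) g)"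
    and "l \<in> \<Lambda> - A \<Longrightarrow> L2_inner M f (\<psi> l) = 0"
proof -
  have fL2: "f \<in> L2 M" using f by (simp add: L2_span_def)
  obtain c where c: "AE x in M. f x = (\<Sum>l\<in>A. c l * \<psi> l x)"
    using f by (auto simp: L2_span_def)
  have \<psi>: "\<psi> l \<in> L2 M" if "l \<in> \<Lambda>" for l
    using on that by (auto simp: orthonormal_system_def)
  have expand: "L2_inner M f g = (\<Sum>l\<in>A. c l * L2_inner M (\<psi> l) g)" if "g \<in> L2 M" for g
  proof -
    have "L2_inner M f g = L2_inner M (\<lambda>x. \<Sum>l\<in>A. c l * \<psi> l x) g"
      using c fL2 that \<psi> A by (intro L2_inner_cong_AE L2_sum) auto
    then show ?thesis using that \<psi> A by (subst (asm) L2_inner_sum_left) auto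
  qed
  have coeff: "L2_inner M f (\<psi> l) = (if l \<in> A then c l else 0)" if l: "l \<in> \<Lambda>" for l
  proof -
    have "L2_inner M f (\<psi> l) = (\<Sum>l'\<in>A. if l' = l then c l' else 0)"
      unfolding expand[OF \<psi>[OF l]] using on A l
      by (intro sum.cong) (auto simp: orthonormal_system_def)
    then show ?thesis using A by simp
  qed
  show "L2_inner M f g = (\<Sum>l\<in>A. L2_inner M f (\<psi> l) * L2_inner M (\<psi> l) g)" if "g \<in> L2 M"
    unfolding expand[OF that] using coeff A by (intro sum.cong) auto
  show "L2_inner M f (\<psi> l) = 0" if "l \<in> \<Lambda> - A" using coeff[of l] that by auto
qed

section \<open>Values of the criterion and their comparison\<close>

definition crit_at ::
    "'a measure \<Rightarrow> ('l \<Rightarrow> 'a \<Rightarrow> real) \<Rightarrow> ('m \<Rightarrow> 'l set) \<Rightarrow> ('m \<Rightarrow> real) \<Rightarrow> real \<Rightarrow>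
     ('l \<Rightarrow> real) \<Rightarrow> ('m \<Rightarrow> 'a \<Rightarrow> real) \<Rightarrow> ('a \<Rightarrow> real) \<Rightarrow> 'm \<Rightarrow> real" where
  "crit_at \<mu> \<psi> \<Lambda>m pen \<alpha> Pb sb shat m =
     (L2_norm \<mu> (sb m))\<^sup>2 - 2 * (\<Sum>l\<in>\<Lambda>m m. L2_inner \<mu> (sb m) (\<psi> l) * Pb l)
        + \<alpha> * (L2_norm \<mu> (\<lambda>x. sb m x - shat x))\<^sup>2 + pen m"

text \<open>A real infimum says something about its members only for a family bounded below. By 2 a
  b \<le> a^2 + b^2 and Bessel's inequality the linear term costs at most the squared norm plus the
  squares of \<open>Pb\<close>; summing the latter over all of \<open>\<Lambda>M\<close> makes the
  bound uniform in the model.\<close>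

lemma crit_bdd_below:
  assumes on: "orthonormal_system \<mu> \<Lambda> \<psi>" and \<Lambda>M: "finite \<Lambda>M" "\<Lambda>M \<subseteq> \<Lambda>"
    and \<Lambda>m: "\<And>m. m \<in> Ms \<Longrightarrow> \<Lambda>m m \<subseteq> \<Lambda>M" and pen: "\<And>m. m \<in> Ms \<Longrightarrow> 0 \<le> pen m" and \<alpha>: "0 \<le> \<alpha>"
    and sb: "\<And>m. m \<in> Ms \<Longrightarrow> sb m \<in> L2 \<mu>"
  shows "bdd_below (crit_at \<mu> \<psi> \<Lambda>m pen \<alpha> Pb sb shat ` Ms)"
proof (rule bdd_belowI2)
  fix m assume m: "m \<in> Ms"
  define b where "b l = L2_inner \<mu> (sb m) (\<psi> l)" for l
  have fin: "finite (\<Lambda>m m)" using \<Lambda>m[OF m] \<Lambda>M finite_subset by blast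
  have "(\<Sum>l\<in>\<Lambda>m m. (b l)\<^sup>2) \<le> (L2_norm \<mu> (sb m))\<^sup>2"
    unfolding b_def using Bessel_inequality[OF on fin _ sb[OF m]] \<Lambda>m[OF m] \<Lambda>M by auto
  moreover have "(\<Sum>l\<in>\<Lambda>m m. 2 * (b l * Pb l)) \<le> (\<Sum>l\<in>\<Lambda>m m. (b l)\<^sup>2 + (Pb l)\<^sup>2)"
    using sum_squares_bound[of "b _" "Pb _"] by (intro sum_mono) (simp add: mult.assoc)
  moreover have "(\<Sum>l\<in>\<Lambda>m m. (Pb l)\<^sup>2) \<le> (\<Sum>l\<in>\<Lambda>M. (Pb l)\<^sup>2)"
    using \<Lambda>m[OF m] \<Lambda>M by (intro sum_mono2) auto
  moreover have "0 \<le> \<alpha> * (L2_norm \<mu> (\<lambda>x. sb m x - shat x))\<^sup>2" using \<alpha> by simp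
  ultimately show "- (\<Sum>l\<in>\<Lambda>M. (Pb l)\<^sup>2) \<le> crit_at \<mu> \<psi> \<Lambda>m pen \<alpha> Pb sb shat m"
    using pen[OF m] by (simp add: crit_at_def b_def sum.distrib sum_distrib_left)
qed

text \<open>
  The coefficients of an element of \<open>S\<^sub>m\<close> vanish outside \<open>\<Lambda>\<^sub>m\<close>, so for two models the difference of
  the noise terms runs over the coefficients of the difference, which Bessel's inequality controls.
\<close>

lemma noise_difference_le:
  assumes on: "orthonormal_system \<mu> \<Lambda> \<psi>" and A: "finite A" "A \<subseteq> \<Lambda>" and A': "finite A'" "A' \<subseteq> \<Lambda>"
    and f: "f \<in> L2_span \<mu> \<psi> A" and g: "g \<in> L2_span \<mu> \<psi> A'" and s: "s \<in> L2 \<mu>" and \<eta>: "0 < \<eta>"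
  shows "2 * ((\<Sum>l\<in>A. L2_inner \<mu> f (\<psi> l) * D l) - (\<Sum>l\<in>A'. L2_inner \<mu> g (\<psi> l) * D l))
    \<le> 2 * \<eta> * ((L2_norm \<mu> (\<lambda>x. f x - s x))\<^sup>2 + (L2_norm \<mu> (\<lambda>x. g x - s x))\<^sup>2)
      + ((\<Sum>l\<in>A. (D l)\<^sup>2) + (\<Sum>l\<in>A'. (D l)\<^sup>2)) / \<eta>"
proof -
  define b where "b l = L2_inner \<mu> f (\<psi> l)" for l
  define b' where "b' l = L2_inner \<mu> g (\<psi> l)" for l
  have fg: "f \<in> L2 \<mu>" "g \<in> L2 \<mu>" using f g by (auto simp: L2_span_def)
  have \<psi>: "\<psi> l \<in> L2 \<mu>" if "l \<in> \<Lambda>" for l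
    using on that by (auto simp: orthonormal_system_def)
  have "(\<Sum>l\<in>A. b l * D l) = (\<Sum>l\<in>A \<union> A'. b l * D l)"
    using A A' L2_inner_span(2)[OF on A f] by (intro sum.mono_neutral_left) (auto simp: b_def)
  moreover have "(\<Sum>l\<in>A'. b' l * D l) = (\<Sum>l\<in>A \<union> A'. b' l * D l)"
    using A A' L2_inner_span(2)[OF on A' g] by (intro sum.mono_neutral_left) (auto simp: b'_def)
  ultimately have "2 * ((\<Sum>l\<in>A. b l * D l) - (\<Sum>l\<in>A'. b' l * D l))
      = (\<Sum>l\<in>A \<union> A'. 2 * ((b l - b' l) * D l))"
    by (simp add: sum_subtractf left_diff_distrib sum_distrib_left right_diff_distrib)
  \<comment> \<open>Young's inequality with weight \<eta>, which trades the distance of the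
    candidates against the size of the noise.\<close>
  also have "\<dots> \<le> (\<Sum>l\<in>A \<union> A'. \<eta> * (b l - b' l)\<^sup>2 + (D l)\<^sup>2 / \<eta>)"
  proof (intro sum_mono)
    fix l
    have "2 * \<eta> * ((b l - b' l) * D l) \<le> (\<eta> * (b l - b' l))\<^sup>2 + (D l)\<^sup>2"
      using sum_squares_bound[of "\<eta> * (b l - b' l)" "D l"] by (simp add: mult.assoc)
    also have "\<dots> = \<eta> * (\<eta> * (b l - b' l)\<^sup>2 + (D l)\<^sup>2 / \<eta>)"
      using \<eta> by (simp add: power2_eq_square distrib_left)
    finally show "2 * ((b l - b' l) * D l) \<le> \<eta> * (b l - b' l)\<^sup>2 + (D l)\<^sup>2 / \<eta>"
      using \<eta> mult_le_cancel_left_pos[OF \<eta>, of "2 * ((b l - b' l) * D l)"] by (simp add: mult_ac)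
  qed
  also have "\<dots> = \<eta> * (\<Sum>l\<in>A \<union> A'. (b l - b' l)\<^sup>2) + (\<Sum>l\<in>A \<union> A'. (D l)\<^sup>2) / \<eta>"
    by (simp add: sum.distrib sum_distrib_left sum_divide_distrib)
  also have "\<dots> \<le> \<eta> * (L2_norm \<mu> (\<lambda>x. f x - g x))\<^sup>2 + ((\<Sum>l\<in>A. (D l)\<^sup>2) + (\<Sum>l\<in>A'. (D l)\<^sup>2)) / \<eta>"
  proof (intro add_mono mult_left_mono divide_right_mono)
    have "(\<Sum>l\<in>A \<union> A'. (b l - b' l)\<^sup>2) = (\<Sum>l\<in>A \<union> A'. (L2_inner \<mu> (\<lambda>x. f x - g x) (\<psi> l))\<^sup>2)"
      using fg \<psi> A A' by (intro sum.cong) (auto simp: b_def b'_def L2_inner_diff_left subset_iff)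
    also have "\<dots> \<le> (L2_norm \<mu> (\<lambda>x. f x - g x))\<^sup>2"
      using A A' fg by (intro Bessel_inequality[OF on] L2_diff) auto
    finally show "(\<Sum>l\<in>A \<union> A'. (b l - b' l)\<^sup>2) \<le> (L2_norm \<mu> (\<lambda>x. f x - g x))\<^sup>2" .
    show "(\<Sum>l\<in>A \<union> A'. (D l)\<^sup>2) \<le> (\<Sum>l\<in>A. (D l)\<^sup>2) + (\<Sum>l\<in>A'. (D l)\<^sup>2)"
      using sum.union_inter[OF A(1) A'(1), of "\<lambda>l. (D l)\<^sup>2"]
        sum_nonneg[of "A \<inter> A'" "\<lambda>l. (D l)\<^sup>2"] by simp
  qed (use \<eta> in auto)
  \<comment> \<open>Passing through \<open>s\<close> doubles \<eta>.\<close>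
  also have "\<eta> * (L2_norm \<mu> (\<lambda>x. f x - g x))\<^sup>2
      \<le> \<eta> * (2 * (L2_norm \<mu> (\<lambda>x. f x - s x))\<^sup>2 + 2 * (L2_norm \<mu> (\<lambda>x. g x - s x))\<^sup>2)"
    using L2_norm_square_diff_le[OF fg(1) s fg(2)] \<eta> L2_norm_diff_commute[of \<mu> s g]
    by (intro mult_left_mono) auto
  finally show ?thesis by (simp add: b_def b'_def distrib_left mult_ac)
qed

text \<open>The deterministic half of the argument, applied outcome by outcome on the good event.
  Primed objects belong to the selected parameter, unprimed ones to its competitor.\<close>

lemma crit_oracle_inequality:
  assumes on: "orthonormal_system \<mu> \<Lambda> \<psi>" and \<Lambda>M: "finite \<Lambda>M" "\<Lambda>M \<subseteq> \<Lambda>"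
    and \<Lambda>m: "\<And>m. m \<in> Ms \<union> Ms' \<Longrightarrow> \<Lambda>m m \<subseteq> \<Lambda>M"
    and pen: "\<And>m. m \<in> Ms \<union> Ms' \<Longrightarrow> 0 \<le> pen m"
    and \<epsilon>: "0 < \<epsilon>" "\<epsilon> < 1 / 4" and \<alpha>: "0 < \<alpha>"
    and noise: "\<And>m. m \<in> Ms \<union> Ms' \<Longrightarrow>
      (\<Sum>l\<in>\<Lambda>m m. (Pb l - L2_inner \<mu> s (\<psi> l))\<^sup>2) \<le> 4 / 9 * \<epsilon> * pen m"
    and s: "s \<in> L2 \<mu>" and f: "f \<in> L2 \<mu>" and f': "f' \<in> L2 \<mu>"
    and sb: "\<And>m. m \<in> Ms \<Longrightarrow> sb m \<in> L2_span \<mu> \<psi> (\<Lambda>m m)"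
    and sb': "\<And>m. m \<in> Ms' \<Longrightarrow> sb' m \<in> L2_span \<mu> \<psi> (\<Lambda>m m)"
    and ne: "Ms \<noteq> {}" "Ms' \<noteq> {}"
    and le: "crit \<mu> \<psi> \<Lambda>m pen \<alpha> Pb Ms' sb' f' \<le> crit \<mu> \<psi> \<Lambda>m pen \<alpha> Pb Ms sb f"
  shows "min (1 - 4 * \<epsilon>) \<alpha> / (2 * (8 + \<alpha>)) * (L2_norm \<mu> (\<lambda>x. f' x - s x))\<^sup>2
    \<le> (L2_norm \<mu> (\<lambda>x. f x - s x))\<^sup>2 + (INF m\<in>Ms. (L2_norm \<mu> (\<lambda>x. f x - sb m x))\<^sup>2 + pen m)"
proof -
  let ?N = "\<lambda>g h. (L2_norm \<mu> (\<lambda>x. g x - h x))\<^sup>2"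
  let ?k = "min (1 - 4 * \<epsilon>) \<alpha>"
  define D where "D l = Pb l - L2_inner \<mu> s (\<psi> l)" for l
  \<comment> \<open>Split \<open>Pb l\<close> into the true coefficient of \<open>s\<close> and the
    error \<open>D l\<close>. The true coefficients sum to the inner product of \<open>sb m\<close>
    with \<open>s\<close>, which completes the square up to the squared norm of \<open>s\<close>;
    that term is common to all candidates and cancels later.\<close>
  have crit_eq: "crit_at \<mu> \<psi> \<Lambda>m pen \<alpha> Pb sb f m =
      ?N (sb m) s - (L2_norm \<mu> s)\<^sup>2 - 2 * (\<Sum>l\<in>\<Lambda>m m. L2_inner \<mu> (sb m) (\<psi> l) * D l)
      + \<alpha> * ?N (sb m) f + pen m"
    if sb: "sb m \<in> L2_span \<mu> \<psi> (\<Lambda>m m)" and m: "m \<in> Ms \<union> Ms'" for sb f m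
  proof -
    have "finite (\<Lambda>m m)" "\<Lambda>m m \<subseteq> \<Lambda>" using \<Lambda>m[OF m] \<Lambda>M finite_subset by blast+
    from L2_inner_span(1)[OF on this sb s] L2_norm_square_diff[of "sb m" \<mu> s] sb s
    show ?thesis
      by (simp add: crit_at_def D_def L2_span_def right_diff_distrib sum_subtractf
          L2_inner_commute[of \<mu> "\<psi> _" s])
  qed
  have main: "?k * ?N f' s \<le> 2 * (8 + \<alpha>) * (?N f s + (?N f (sb m) + pen m)) + 2 * e"
    if m: "m \<in> Ms" and e: "0 < e" for m e
  proof -
    have "(INF m\<in>Ms'. crit_at \<mu> \<psi> \<Lambda>m pen \<alpha> Pb sb' f' m) \<le> (INF m\<in>Ms. crit_at \<mu> \<psi> \<Lambda>m pen \<alpha> Pb sb f m)"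
      using le unfolding crit_def crit_at_def .
    also have "\<dots> \<le> crit_at \<mu> \<psi> \<Lambda>m pen \<alpha> Pb sb f m"
      using m sb \<alpha> \<Lambda>m pen
      by (intro cINF_lower crit_bdd_below[OF on \<Lambda>M]) (auto simp: L2_span_def)
    also have "\<dots> < crit_at \<mu> \<psi> \<Lambda>m pen \<alpha> Pb sb f m + e" using e by simp
    \<comment> \<open>The infimum over \<open>Ms'\<close> need not be attained; the slack
      \<open>e\<close> yields a model whose value is below that of the competitor plus
      \<open>e\<close>.\<close>
    finally obtain m' where m': "m' \<in> Ms'"
      and lt: "crit_at \<mu> \<psi> \<Lambda>m pen \<alpha> Pb sb' f' m' < crit_at \<mu> \<psi> \<Lambda>m pen \<alpha> Pb sb f m + e"
      using sb' \<alpha> \<Lambda>m pen ne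
      by (subst (asm) cINF_less_iff) (auto intro!: crit_bdd_below[OF on \<Lambda>M] simp: L2_span_def)
    have fin: "finite (\<Lambda>m m)" "\<Lambda>m m \<subseteq> \<Lambda>" "finite (\<Lambda>m m')" "\<Lambda>m m' \<subseteq> \<Lambda>"
      using \<Lambda>m[of m] \<Lambda>m[of m'] m m' \<Lambda>M finite_subset by blast+
    have L2: "sb m \<in> L2 \<mu>" "sb' m' \<in> L2 \<mu>" using sb[OF m] sb'[OF m'] by (auto simp: L2_span_def)
    \<comment> \<open>The weight \<eta> = 2 \<epsilon> puts 4 \<epsilon> before the squared
      distances and turns the noise bound 4 \<epsilon> pen / 9 into 2 pen / 9.\<close>
    have "2 * ((\<Sum>l\<in>\<Lambda>m m'. L2_inner \<mu> (sb' m') (\<psi> l) * D l) - (\<Sum>l\<in>\<Lambda>m m. L2_inner \<mu> (sb m) (\<psi> l) * D l))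
      \<le> 2 * (2 * \<epsilon>) * (?N (sb' m') s + ?N (sb m) s)
        + ((\<Sum>l\<in>\<Lambda>m m'. (D l)\<^sup>2) + (\<Sum>l\<in>\<Lambda>m m. (D l)\<^sup>2)) / (2 * \<epsilon>)"
      using \<epsilon> by (intro noise_difference_le[OF on fin(3,4,1,2) sb'[OF m'] sb[OF m] s]) auto
    also have "\<dots> \<le> 2 * (2 * \<epsilon>) * (?N (sb' m') s + ?N (sb m) s) + 2 / 9 * (pen m' + pen m)"
    proof -
      have "(\<Sum>l\<in>\<Lambda>m m'. (D l)\<^sup>2) + (\<Sum>l\<in>\<Lambda>m m. (D l)\<^sup>2) \<le> (2 / 9 * (pen m' + pen m)) * (2 * \<epsilon>)"
        using noise[of m] noise[of m'] m m' by (simp add: D_def algebra_simps)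
      then show ?thesis using \<epsilon> by (simp add: pos_divide_le_eq)
    qed
    finally have cross: "2 * (\<Sum>l\<in>\<Lambda>m m'. L2_inner \<mu> (sb' m') (\<psi> l) * D l)
        - 2 * (\<Sum>l\<in>\<Lambda>m m. L2_inner \<mu> (sb m) (\<psi> l) * D l)
      \<le> 4 * \<epsilon> * ?N (sb' m') s + 4 * \<epsilon> * ?N (sb m) s + 2 / 9 * pen m' + 2 / 9 * pen m"
      by (simp add: distrib_left right_diff_distrib mult.assoc)
    have pos: "0 \<le> pen m" "0 \<le> pen m'" using pen m m' by auto
    \<comment> \<open>The penalty of \<open>m'\<close> absorbs its noise share 2/9 and is then
      dropped; that of \<open>m\<close> grows to 11/9, rounded up to 2.\<close>
    have A: "(1 - 4 * \<epsilon>) * ?N (sb' m') s + \<alpha> * ?N (sb' m') f'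
        \<le> ?N (sb m) s + 4 * \<epsilon> * ?N (sb m) s + \<alpha> * ?N (sb m) f + 2 * pen m + e"
    proof -
      have "m' \<in> Ms \<union> Ms'" "m \<in> Ms \<union> Ms'" using m m' by auto
      note eqs = crit_eq[of sb' m' f', OF sb'[OF m'] this(1)] crit_eq[of sb m f, OF sb[OF m] this(2)]
      show ?thesis
        using lt cross pos unfolding eqs left_diff_distrib by linarith
    qed
    have B: "4 * \<epsilon> * ?N (sb m) s \<le> 1 * ?N (sb m) s" using \<epsilon> by (intro mult_right_mono) auto
    have C: "?N (sb m) s \<le> 2 * ?N f (sb m) + 2 * ?N f s" "?N f' s \<le> 2 * ?N (sb' m') f' + 2 * ?N (sb' m') s"
      using L2_norm_square_diff_le[OF L2(1) f s] L2_norm_square_diff_le[OF f' L2(2) s]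
      unfolding L2_norm_diff_commute[of \<mu> f "sb m"] L2_norm_diff_commute[of \<mu> f' "sb' m'"] by auto
    have k: "0 \<le> ?k" using \<epsilon> \<alpha> by simp
    have "?k * ?N f' s \<le> ?k * (2 * ?N (sb' m') f' + 2 * ?N (sb' m') s)"
      using C(2) k by (rule mult_left_mono)
    also have "\<dots> = 2 * (?k * ?N (sb' m') s + ?k * ?N (sb' m') f')" by (simp add: algebra_simps)
    also have "\<dots> \<le> 2 * ((1 - 4 * \<epsilon>) * ?N (sb' m') s + \<alpha> * ?N (sb' m') f')"
      by (intro mult_left_mono add_mono mult_right_mono) auto
    also have "\<dots> \<le> 2 * (?N (sb m) s + 4 * \<epsilon> * ?N (sb m) s + \<alpha> * ?N (sb m) f + 2 * pen m + e)"
      using A by (rule mult_left_mono) simp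
    \<comment> \<open>By \<open>B\<close> and \<open>C\<close> the first two terms are at most 4
      \<open>?N f s\<close> + 4 \<open>?N f (sb m)\<close>. The resulting coefficients 4, 4 +
      \<alpha> and 2 are all at most 8 + \<alpha>.\<close>
    also have "\<dots> \<le> 2 * ((8 + \<alpha>) * (?N f s + (?N f (sb m) + pen m)) + e)"
    proof (rule mult_left_mono)
      have "0 \<le> \<alpha> * ?N f s" "0 \<le> \<alpha> * pen m" using \<alpha> pos by auto
      then show "?N (sb m) s + 4 * \<epsilon> * ?N (sb m) s + \<alpha> * ?N (sb m) f + 2 * pen m + e
          \<le> (8 + \<alpha>) * (?N f s + (?N f (sb m) + pen m)) + e"
        using B C(1) pos zero_le_power2[of "L2_norm \<mu> (\<lambda>x. f x - s x)"]
          zero_le_power2[of "L2_norm \<mu> (\<lambda>x. f x - sb m x)"]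
        unfolding L2_norm_diff_commute[of \<mu> "sb m" f] distrib_left distrib_right
        by linarith
    qed simp
    finally show ?thesis by (simp only: ring_distribs mult.assoc)
  qed
  have "?k / (2 * (8 + \<alpha>)) * ?N f' s - ?N f s \<le> ?N f (sb m) + pen m" if m: "m \<in> Ms" for m
  proof -
    define R where "R = ?N f s + (?N f (sb m) + pen m)"
    define c where "c = 2 * (8 + \<alpha>)"
    have c: "0 < c" using \<alpha> by (simp add: c_def)
    have "?k * ?N f' s \<le> c * R"
    proof (rule field_le_epsilon)
      fix e :: real assume "0 < e"
      then show "?k * ?N f' s \<le> c * R + e"
        using main[OF m, of "e / 2"] unfolding R_def c_def by linarith
    qed
    then have "?k * ?N f' s / c \<le> R"
      using c by (subst pos_divide_le_eq) (auto simp only: mult.commute)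
    then have "?k / c * ?N f' s \<le> R" by (simp only: times_divide_eq_left)
    then show ?thesis unfolding R_def c_def by linarith
  qed
  then have "?k / (2 * (8 + \<alpha>)) * ?N f' s - ?N f s \<le> (INF m\<in>Ms. ?N f (sb m) + pen m)"
    using ne by (intro cINF_greatest) auto
  then show ?thesis by linarith
qed

section \<open>Union bound over the orthonormal functions and the oracle inequality\<close>

theorem theorem8:
  fixes \<Omega> :: "'w measure" and \<mu> :: "'a measure"
    and n :: nat and X :: "nat \<Rightarrow> 'w \<Rightarrow> 'a" and s :: "'a \<Rightarrow> real"
    and \<delta> \<epsilon> \<alpha> :: real
    and \<Lambda> \<Lambda>M :: "'l set" and \<psi> :: "'l \<Rightarrow> 'a \<Rightarrow> real"
    and \<M> :: "'m set" and \<Lambda>m :: "'m \<Rightarrow> 'l set"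
    and \<Theta> :: "'t set" and shat :: "'t \<Rightarrow> 'w \<Rightarrow> 'a \<Rightarrow> real"
    and \<M>\<theta> :: "'t \<Rightarrow> 'w \<Rightarrow> 'm set" and sbreve :: "'t \<Rightarrow> 'm \<Rightarrow> 'w \<Rightarrow> 'a \<Rightarrow> real"
    and \<pi> :: "'l pmf" and V :: "'l \<Rightarrow> nat" and B :: "'l \<Rightarrow> nat \<Rightarrow> nat set"
    and Pbar :: "'l \<Rightarrow> 'w \<Rightarrow> real"
    and pen :: "'m \<Rightarrow> real" and \<theta>hat :: "'w \<Rightarrow> 't"
  assumes prob: "prob_space \<Omega>"
    and indep: "prob_space.indep_vars \<Omega> (\<lambda>_. \<mu>) X {1..n}"
    and density: "\<forall>i\<in>{1..n}. distributed \<Omega> \<mu> (X i) (\<lambda>x. ennreal (s x))"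
    and s_nonneg: "AE x in \<mu>. 0 \<le> s x"
    and s_L2: "s \<in> L2 \<mu>"
    and \<delta>: "0 < \<delta>" "\<delta> < 1"
    and \<epsilon>: "0 < \<epsilon>" "\<epsilon> < 1 / 4"
    and \<alpha>: "0 < \<alpha>"
    and orthonormal: "orthonormal_system \<mu> \<Lambda> \<psi>"
    and \<Lambda>M: "finite \<Lambda>M" "\<Lambda>M \<subseteq> \<Lambda>"
    and \<Lambda>m: "\<forall>m\<in>\<M>. \<Lambda>m m \<subseteq> \<Lambda>M"
    and shat: "\<forall>\<theta>\<in>\<Theta>. L2_random_element \<Omega> (space \<Omega>) \<mu> (shat \<theta>)"
    and \<M>\<theta>: "\<forall>\<theta>\<in>\<Theta>. \<forall>\<omega>\<in>space \<Omega>. \<M>\<theta> \<theta> \<omega> \<noteq> {} \<and> \<M>\<theta> \<theta> \<omega> \<subseteq> \<M>"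
    and \<M>\<theta>_random: "\<forall>\<theta>\<in>\<Theta>. \<forall>m\<in>\<M>. {\<omega>\<in>space \<Omega>. m \<in> \<M>\<theta> \<theta> \<omega>} \<in> sets \<Omega>"
    and sbreve: "\<forall>\<theta>\<in>\<Theta>. \<forall>m\<in>\<M>.
        L2_random_element \<Omega> {\<omega>\<in>space \<Omega>. m \<in> \<M>\<theta> \<theta> \<omega>} \<mu> (sbreve \<theta> m)"
    and sbreve_span: "\<forall>\<theta>\<in>\<Theta>. \<forall>\<omega>\<in>space \<Omega>. \<forall>m\<in>\<M>\<theta> \<theta> \<omega>.
        sbreve \<theta> m \<omega> \<in> L2_span \<mu> \<psi> (\<Lambda>m m)"
    and \<pi>: "set_pmf \<pi> \<subseteq> \<Lambda>M"
    and partitions: "\<forall>l\<in>\<Lambda>M. regular_partition n (V l) (B l)"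
    and blocks: "\<forall>l\<in>\<Lambda>M. 0 < pmf \<pi> l \<and> ln (2 / (pmf \<pi> l * \<delta>)) \<le> real (V l) \<and> real (V l) \<le> real n / 2"
    and medians: "\<forall>l\<in>\<Lambda>M. \<forall>\<omega>\<in>space \<Omega>.
        is_median (V l) (\<lambda>K. block_mean (\<lambda>i. X i \<omega>) (B l K) (\<psi> l)) (Pbar l \<omega>)"
    and pen_nonneg: "\<forall>m\<in>\<M>. 0 \<le> pen m"
    and pen: "\<forall>m\<in>\<M>. ennreal (pen m) \<ge> ennreal (L4_const / (\<epsilon> * real n)) *
        (\<Sum>l\<in>\<Lambda>m m. evar (density \<mu> (\<lambda>x. ennreal (s x))) (\<psi> l) * of_nat (V l))"
    and argmin: "\<forall>\<omega>\<in>space \<Omega>. is_arg_min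
        (\<lambda>\<theta>. crit \<mu> \<psi> \<Lambda>m pen \<alpha> (\<lambda>l. Pbar l \<omega>) (\<M>\<theta> \<theta> \<omega>) (\<lambda>m. sbreve \<theta> m \<omega>) (shat \<theta> \<omega>))
        (\<lambda>\<theta>. \<theta> \<in> \<Theta>) (\<theta>hat \<omega>)"
  shows "\<exists>A\<in>sets \<Omega>. measure \<Omega> A \<ge> 1 - \<delta> / 2 \<and>
    (\<forall>\<omega>\<in>A. \<forall>\<theta>\<in>\<Theta>.
      min (1 - 4 * \<epsilon>) \<alpha> / (2 * (8 + \<alpha>)) * (L2_norm \<mu> (\<lambda>x. shat (\<theta>hat \<omega>) \<omega> x - s x))\<^sup>2
      \<le> (L2_norm \<mu> (\<lambda>x. shat \<theta> \<omega> x - s x))\<^sup>2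
        + (INF m\<in>\<M>\<theta> \<theta> \<omega>. (L2_norm \<mu> (\<lambda>x. shat \<theta> \<omega> x - sbreve \<theta> m \<omega> x))\<^sup>2 + pen m))"
proof -
  interpret prob_space \<Omega> by (rule prob)
  define P where "P = density \<mu> (\<lambda>x. ennreal (s x))"
  define p where "p l = (\<integral>x. \<psi> l x \<partial>P)" for l
  define \<sigma>2 where "\<sigma>2 l = (\<integral>x. (\<psi> l x - p l)\<^sup>2 \<partial>P)" for l
  define t where "t l = L1_const * sqrt (\<sigma>2 l * real (V l) / real n)" for l
  \<comment> \<open>Chebyshev's inequality gives nothing for functions of infinite variance, so only
    the others enter the union bound. The penalty condition will show that no model contains an
    excluded index.\<close>
  define S where "S = {l\<in>\<Lambda>M. evar P (\<psi> l) < \<infinity>}"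
  \<comment> \<open>The event is phrased by block means rather than by \<open>Pbar\<close>, whose
    measurability is not assumed.\<close>
  define Bad where "Bad l = {\<omega>\<in>space \<Omega>. real (V l) / 2 \<le>
      real (card {K\<in>{1..V l}. t l < \<bar>block_mean (\<lambda>i. X i \<omega>) (B l K) (\<psi> l) - p l\<bar>})}" for l
  define A where "A = space \<Omega> - (\<Union>l\<in>S. Bad l)"
  have S: "finite S" "S \<subseteq> \<Lambda>M" using \<Lambda>M by (auto simp: S_def)
  have V: "0 < V l" if l: "l \<in> \<Lambda>M" for l
  proof -
    have "pmf \<pi> l * \<delta> \<le> 1 * 1" using \<delta> pmf_le_1[of \<pi> l] by (intro mult_mono) auto
    moreover have "0 < pmf \<pi> l * \<delta>" using blocks l \<delta> by simp
    ultimately have "1 < 2 / (pmf \<pi> l * \<delta>)" by (simp add: field_simps)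
    then have "0 < ln (2 / (pmf \<pi> l * \<delta>))" by (rule ln_gt_zero)
    also have "\<dots> \<le> real (V l)" using blocks l by simp
    finally show ?thesis by simp
  qed
  have "set_pmf \<pi> \<noteq> {}" by (rule set_pmf_not_empty)
  then obtain l0 where "l0 \<in> \<Lambda>M" using \<pi> by auto
  with V[of l0] blocks have n: "0 < n" by (cases n) auto
  have s[measurable]: "s \<in> borel_measurable \<mu>" using s_L2 by (rule L2_D)
  have \<psi>L2: "\<psi> l \<in> L2 \<mu>" if "l \<in> \<Lambda>M" for l
    using orthonormal \<Lambda>M that by (auto simp: orthonormal_system_def)
  have \<psi>: "\<psi> l \<in> borel_measurable \<mu>" if "l \<in> \<Lambda>M" for l
    using \<psi>L2[OF that] by (rule L2_D)
  have law: "distr \<Omega> \<mu> (X i) = P" if "i \<in> {1..n}" for i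
    using density that by (auto simp: P_def intro: distributed_distr_eq_density)
  interpret P: prob_space P
  proof -
    have "X 1 \<in> measurable \<Omega> \<mu>" using density n by (auto simp: distributed_def)
    then show "prob_space P" using law[of 1] n prob_space_distr[of "X 1" \<mu>] by auto
  qed
  have \<psi>P: "\<psi> l \<in> borel_measurable P" if "l \<in> \<Lambda>M" for l
    using \<psi>[OF that] by (simp add: P_def)
  \<comment> \<open>Since \<open>s\<close> is the density of \<open>P\<close>, the coefficients of
    \<open>s\<close> are the means that the medians estimate.\<close>
  have mean: "L2_inner \<mu> s (\<psi> l) = p l" if "l \<in> \<Lambda>M" for l
    using integral_density[OF \<psi>[OF that] s s_nonneg] by (simp add: p_def P_def L2_inner_def)
  have Bad: "Bad l \<in> events" "prob (Bad l) \<le> pmf \<pi> l * \<delta> / 2" if l: "l \<in> S" for l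
  proof -
    have l': "l \<in> \<Lambda>M" and fin: "evar P (\<psi> l) < \<infinity>" using l by (auto simp: S_def)
    have sq: "integrable P (\<lambda>x. (\<psi> l x)\<^sup>2)"
      using \<psi>P[OF l'] fin by (rule P.evar_finite_imp_square_integrable)
    have reg: "regular_partition n (V l) (B l)" and Vn: "real (V l) \<le> real n / 2"
      using partitions blocks l' by auto
    note dev = prob_half_blocks_deviate_le[OF indep law \<psi>[OF l'] sq reg V[OF l'] Vn]
    show "Bad l \<in> events" using dev(1) unfolding Bad_def t_def \<sigma>2_def p_def .
    have "prob (Bad l) \<le> exp (- real (V l))"
      using dev(2) unfolding Bad_def t_def \<sigma>2_def p_def .
    \<comment> \<open>The lower bound on the number of blocks gives each index its share of \<delta>
      / 2, in proportion to its weight under \<pi>.\<close>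
    also have "\<dots> \<le> exp (- ln (2 / (pmf \<pi> l * \<delta>)))" using blocks l' by simp
    also have "\<dots> = pmf \<pi> l * \<delta> / 2"
    proof -
      have "0 < 2 / (pmf \<pi> l * \<delta>)" using blocks l' \<delta> by simp
      then show ?thesis by (simp add: exp_minus)
    qed
    finally show "prob (Bad l) \<le> pmf \<pi> l * \<delta> / 2" .
  qed
  have UN: "(\<Union>l\<in>S. Bad l) \<in> events" using S Bad by auto
  have "prob (\<Union>l\<in>S. Bad l) \<le> (\<Sum>l\<in>S. prob (Bad l))"
    using S Bad by (intro finite_measure_subadditive_finite) auto
  also have "\<dots> \<le> (\<Sum>l\<in>S. pmf \<pi> l * \<delta> / 2)" using Bad by (intro sum_mono)
  also have "\<dots> = (\<Sum>l\<in>S. pmf \<pi> l) * (\<delta> / 2)" by (simp add: sum_distrib_right)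
  also have "\<dots> \<le> 1 * (\<delta> / 2)"
  proof (intro mult_right_mono)
    show "(\<Sum>l\<in>S. pmf \<pi> l) \<le> 1"
      using S by (simp flip: measure_measure_pmf_finite)
  qed (use \<delta> in simp)
  finally have prob_A: "1 - \<delta> / 2 \<le> prob A"
    unfolding A_def using UN by (subst prob_compl) auto
  have noise: "(\<Sum>l\<in>\<Lambda>m m. (Pbar l \<omega> - L2_inner \<mu> s (\<psi> l))\<^sup>2) \<le> 4 / 9 * \<epsilon> * pen m"
    if \<omega>: "\<omega> \<in> A" and m: "m \<in> \<M>" for \<omega> m
  proof -
    have sub: "\<Lambda>m m \<subseteq> \<Lambda>M" and fin: "finite (\<Lambda>m m)"
      using \<Lambda>m m \<Lambda>M finite_subset by blast+
    have L1: "L1_const\<^sup>2 = 2 / r_const" using r_const_bounds by (simp add: L1_const_def)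
    have L4: "0 < L4_const / (\<epsilon> * real n)"
      using r_const_bounds \<epsilon> n by (simp add: L4_const_def L1)
    have \<sigma>2: "0 \<le> \<sigma>2 l" for l unfolding \<sigma>2_def by simp
    have penm: "ennreal (L4_const / (\<epsilon> * real n)) * (\<Sum>l\<in>\<Lambda>m m. evar P (\<psi> l) * of_nat (V l))
        \<le> ennreal (pen m)"
      using pen m by (simp add: P_def)
    also have "\<dots> < top" by simp
    finally have "(\<Sum>l\<in>\<Lambda>m m. evar P (\<psi> l) * of_nat (V l)) < top"
      using L4 by (auto simp: ennreal_mult_less_top)
    \<comment> \<open>Positivity of \<open>V l\<close> matters here: in \<open>ennreal\<close> a
      product of \<infinity> and 0 is 0.\<close>
    then have "evar P (\<psi> l) < \<infinity>" if "l \<in> \<Lambda>m m" for l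
      using fin that V[of l] sub by (fastforce simp: ennreal_mult_less_top)
    then have inS: "\<Lambda>m m \<subseteq> S" using sub by (auto simp: S_def)
    have evar: "evar P (\<psi> l) = ennreal (\<sigma>2 l)" if "l \<in> \<Lambda>m m" for l
      using P.evar_finite_eq_variance[OF \<psi>P, of l] inS that by (auto simp: S_def \<sigma>2_def p_def)
    have "(\<Sum>l\<in>\<Lambda>m m. evar P (\<psi> l) * of_nat (V l)) = ennreal (\<Sum>l\<in>\<Lambda>m m. \<sigma>2 l * real (V l))"
      using \<sigma>2 by (simp add: evar sum_ennreal[symmetric] ennreal_mult ennreal_of_nat_eq_real_of_nat)
    with penm have "ennreal (L4_const / (\<epsilon> * real n) * (\<Sum>l\<in>\<Lambda>m m. \<sigma>2 l * real (V l))) \<le> ennreal (pen m)"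
      using L4 \<sigma>2 by (subst ennreal_mult) (auto simp: sum_nonneg)
    then have pen_ge: "L4_const / (\<epsilon> * real n) * (\<Sum>l\<in>\<Lambda>m m. \<sigma>2 l * real (V l)) \<le> pen m"
      using pen_nonneg m by (simp add: ennreal_le_iff)
    have "(Pbar l \<omega> - L2_inner \<mu> s (\<psi> l))\<^sup>2 \<le> L1_const\<^sup>2 / real n * (\<sigma>2 l * real (V l))"
      if l: "l \<in> \<Lambda>m m" for l
    proof -
      \<comment> \<open>Outside \<open>Bad l\<close> fewer than half of the block means deviate by
        more than \<open>t l\<close>, hence neither does their median.\<close>
      have l': "l \<in> \<Lambda>M" "\<omega> \<in> space \<Omega>" "\<omega> \<notin> Bad l" using l sub inS \<omega> by (auto simp: A_def)
      then have "\<not> t l < \<bar>Pbar l \<omega> - p l\<bar>"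
        using median_deviation_imp_half_deviate[of "V l" _ "Pbar l \<omega>" "t l" "p l"] medians
        by (auto simp: Bad_def)
      then have "\<bar>Pbar l \<omega> - p l\<bar>\<^sup>2 \<le> (t l)\<^sup>2" by (intro power_mono) auto
      then show ?thesis
        using \<sigma>2[of l] by (simp add: mean[OF l'(1)] t_def power_mult_distrib)
    qed
    then have "(\<Sum>l\<in>\<Lambda>m m. (Pbar l \<omega> - L2_inner \<mu> s (\<psi> l))\<^sup>2)
        \<le> (\<Sum>l\<in>\<Lambda>m m. L1_const\<^sup>2 / real n * (\<sigma>2 l * real (V l)))"
      by (rule sum_mono)
    \<comment> \<open>The factor 4/9 inverts the 9/4 in \<open>L4_const\<close>.\<close>
    also have "\<dots> = 4 / 9 * \<epsilon> * (L4_const / (\<epsilon> * real n) * (\<Sum>l\<in>\<Lambda>m m. \<sigma>2 l * real (V l)))"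
      unfolding sum_distrib_left[symmetric] using \<epsilon> n by (simp add: L4_const_def)
    also have "\<dots> \<le> 4 / 9 * \<epsilon> * pen m"
      using pen_ge \<epsilon> by (intro mult_left_mono) auto
    finally show ?thesis .
  qed
  show ?thesis
  proof (intro bexI[of _ A] conjI ballI)
    fix \<omega> \<theta> assume \<omega>: "\<omega> \<in> A" and \<theta>: "\<theta> \<in> \<Theta>"
    have \<omega>': "\<omega> \<in> space \<Omega>" using \<omega> by (simp add: A_def)
    have \<theta>hat: "\<theta>hat \<omega> \<in> \<Theta>"
      and le: "crit \<mu> \<psi> \<Lambda>m pen \<alpha> (\<lambda>l. Pbar l \<omega>) (\<M>\<theta> (\<theta>hat \<omega>) \<omega>) (\<lambda>m. sbreve (\<theta>hat \<omega>) m \<omega>) (shat (\<theta>hat \<omega>) \<omega>)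
        \<le> crit \<mu> \<psi> \<Lambda>m pen \<alpha> (\<lambda>l. Pbar l \<omega>) (\<M>\<theta> \<theta> \<omega>) (\<lambda>m. sbreve \<theta> m \<omega>) (shat \<theta> \<omega>)"
      using argmin \<omega>' \<theta> by (auto simp: is_arg_min_def not_less)
    have sub: "m \<in> \<M>" if "m \<in> \<M>\<theta> \<theta> \<omega> \<union> \<M>\<theta> (\<theta>hat \<omega>) \<omega>" for m
      using that \<M>\<theta> \<theta> \<theta>hat \<omega>' by blast
    show "min (1 - 4 * \<epsilon>) \<alpha> / (2 * (8 + \<alpha>)) * (L2_norm \<mu> (\<lambda>x. shat (\<theta>hat \<omega>) \<omega> x - s x))\<^sup>2
      \<le> (L2_norm \<mu> (\<lambda>x. shat \<theta> \<omega> x - s x))\<^sup>2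
        + (INF m\<in>\<M>\<theta> \<theta> \<omega>. (L2_norm \<mu> (\<lambda>x. shat \<theta> \<omega> x - sbreve \<theta> m \<omega> x))\<^sup>2 + pen m)"
    \<comment> \<open>The event \<open>A\<close> depends on neither the parameter nor the model, so
      the inequality holds for all parameters at once, also with random model sets and a random
      \<open>\<theta>hat\<close>.\<close>
    proof (rule crit_oracle_inequality[OF orthonormal \<Lambda>M _ _ \<epsilon> \<alpha> _ s_L2 _ _ _ _ _ _ le])
      show "\<Lambda>m m \<subseteq> \<Lambda>M" "0 \<le> pen m"
        "(\<Sum>l\<in>\<Lambda>m m. (Pbar l \<omega> - L2_inner \<mu> s (\<psi> l))\<^sup>2) \<le> 4 / 9 * \<epsilon> * pen m"
        if "m \<in> \<M>\<theta> \<theta> \<omega> \<union> \<M>\<theta> (\<theta>hat \<omega>) \<omega>" for m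
        using sub[OF that] \<Lambda>m pen_nonneg noise[OF \<omega>] by auto
    qed (use shat sbreve_span \<M>\<theta> \<theta> \<theta>hat \<omega>' in \<open>auto simp: L2_random_element_def\<close>)
  qed (use prob_A UN in \<open>auto simp: A_def\<close>)
qed

end
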